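(* Let $G=(V(G),E(G))$ be a finite simple digraph with $V(G)=\{v_1,\dots,v_n\}$, and let $H_G$ be its associated undirected bipartite graph on $\{v_1,\dots,v_n,z_1,\dots,z_n\}$. Then the following are equivalent: (i) the indices can be relabelled so that every edge of $H_G$ goes from a $z$ to a $v$ of at least as large index, i.e. there exists a permutation $\pi$ of $\{1,\dots,n\}$ such that for all $i,j\in\{1,\dots,n\}$, $\{z_i,v_j\}\in E(H_G)$ implies $\pi(i)\le\pi(j)$; (ii) $G$ is a directed acyclic graph.
   Context: A digraph $G$ is a finite directed graph; $[v_i,v_j]$ denotes the directed edge from $v_i$ to $v_j$. Simple means without multiple edges and without loops (two oppositely directed edges $[v_i,v_j]$, $[v_j,v_i]$ form a directed cycle of length 2). A directed acyclic graph (DAG) is a digraph with no directed cycles. For a digraph $G$ with $V(G)=\{v_1,\dots,v_n\}$, introduce new vertices $z_1,\dots,z_n$. The graph $H_G$ is the undirected graph with vertex set $V(H_G)=\{v_1,\dots,v_n,z_1,\dots,z_n\}$ and edge set $E(H_G)=\{\{z_i,v_j\} : [v_i,v_j]\in E(G)\}\cup\{\{z_i,v_i\} : i=1,\dots,n\}$. *)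

theory Defs
  imports "Graph_Theory.Arc_Walk" "HOL-Combinatorics.Permutations"
begin

text \<open>
  Finite simple digraphs are the locale \<^locale>\<open>digraph\<close>: finite, without loops and without
  parallel arcs; oppositely directed arcs are allowed and form a cycle of length 2.
\<close>

definition directed_acyclic :: "('a, 'b) pre_digraph \<Rightarrow> bool" where
  "directed_acyclic G \<longleftrightarrow> fin_digraph G \<and> \<not> (\<exists>p. pre_digraph.cycle G p)"

record 'w ugraph =
  uverts :: "'w set"
  uedges :: "'w set set"

text \<open>
  A new vertex carries only its index: \<open>Z i\<close> is the vertex $z_i$, while \<open>V x\<close> is the copy of the
  vertex \<open>x\<close> of \<open>G\<close>, so that \<open>V (v j)\<close> is $v_j$.
\<close>

datatype 'a H_vertex = V 'a | Z nat

definition H_graph :: "nat \<Rightarrow> (nat \<Rightarrow> 'a) \<Rightarrow> ('a, 'b) pre_digraph \<Rightarrow> 'a H_vertex ugraph" where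
  "H_graph n v G = \<lparr>
     uverts = {V (v i) | i. i \<in> {1..n}} \<union> {Z i | i. i \<in> {1..n}},
     uedges = {{Z i, V (v j)} | i j. i \<in> {1..n} \<and> j \<in> {1..n} \<and> (v i, v j) \<in> arcs_ends G}
              \<union> {{Z i, V (v i)} | i. i \<in> {1..n}} \<rparr>"

end

theory Submission
  imports Defs
begin

text \<open>
  Apart from the edges \<open>{Z i, V (v i)}\<close>, on which the condition \<open>\<pi> i \<le> \<pi> j\<close> is trivial, the edges
  of \<open>H_graph n v G\<close> are exactly the arcs of \<open>G\<close>, with tails read off the \<open>Z\<close> side and heads off the
  \<open>V\<close> side (\<open>Z_V_edge_iff\<close>). As \<open>G\<close> has no loops and \<open>\<pi>\<close> is injective, \<open>\<pi> i \<le> \<pi> j\<close> along an arc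
  is the same as \<open>\<pi> i < \<pi> j\<close>. So a relabelling as required is nothing but a topological
  numbering of \<open>G\<close>.

  If such a numbering exists then labels strictly increase along every walk, so no walk can
  close up. Conversely, the arc relation of an acyclic digraph is an acyclic relation on a finite
  set, and numbering sinks with the largest labels first yields a topological numbering
  (\<open>acyclic_imp_topological_numbering\<close>). The passage between cycles, which are lists of arcs, and
  acyclicity of the relation \<open>arcs_ends G\<close> is \<open>acyclic_arcs_ends_iff\<close>.
\<close>

text \<open>
  A vertex related to itself by the transitive closure lies on a nonempty closed walk. Such a walk
  contains a cycle: any closed piece between two visits of a vertex is a shorter closed walk, and
  a shortest one repeats no vertex.
\<close>
lemma (in wf_digraph) acyclic_arcs_ends_iff:
  "acyclic (arcs_ends G) \<longleftrightarrow> \<not> (\<exists>p. cycle p)"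
proof -
  have "(\<exists>u. u \<rightarrow>\<^sup>+ u) \<longleftrightarrow> (\<exists>p. closed_w p)"
    by (auto simp: reachable1_awalk closed_w_def)
  also have "\<dots> \<longleftrightarrow> (\<exists>p. cycle p)"
    using closed_w_imp_cycle by (auto simp: cycle_altdef)
  finally show ?thesis
    by (auto simp: acyclic_def)
qed

text \<open>
  A nonempty finite set has an element with no successor in the set, since otherwise following
  successors would run into a loop. It can safely receive the largest label, and the
  remaining elements are numbered by induction.
\<close>
lemma acyclic_imp_topological_numbering:
  assumes "finite A" and acyc: "acyclic r"
  shows "\<exists>f. bij_betw f A {1..card A} \<and> (\<forall>x\<in>A. \<forall>y\<in>A. (x, y) \<in> r \<longrightarrow> f x < f y)"
  using \<open>finite A\<close>
proof (induction A rule: finite_psubset_induct)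
  case (psubset A)
  show ?case
  proof (cases "A = {}")
    case True
    then show ?thesis by (simp add: bij_betw_def)
  next
    case False
    let ?R = "r \<inter> A \<times> A"
    have "finite ?R" "acyclic ?R"
      using psubset.hyps acyc by (auto intro: acyclic_subset)
    then have "wf (?R\<inverse>)"
      by (rule finite_acyclic_wf_converse)
    moreover obtain a where "a \<in> A"
      using False by blast
    ultimately obtain s where s: "s \<in> A" and "\<And>y. (y, s) \<in> ?R\<inverse> \<Longrightarrow> y \<notin> A"
      by (rule wfE_min) blast
    then have sink: "(s, y) \<notin> r" if "y \<in> A" for y
      using that by blast
    obtain m where m: "card A = Suc m" "card (A - {s}) = m"
      using card_Suc_Diff1[OF psubset.hyps s] by metis
    from psubset.IH[of "A - {s}"] s obtain f where
      f: "bij_betw f (A - {s}) {1..m}"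
      and mono: "\<And>x y. \<lbrakk>x \<in> A - {s}; y \<in> A - {s}; (x, y) \<in> r\<rbrakk> \<Longrightarrow> f x < f y"
      unfolding m(2) by blast
    let ?f = "f(s := Suc m)"
    have "bij_betw ?f (A - {s}) {1..m}"
      using f by (subst bij_betw_cong[where g = f]) auto
    then have "bij_betw ?f (A - {s} \<union> {s}) ({1..m} \<union> {?f s})"
      by (rule notIn_Un_bij_betw[rotated 2]) auto
    moreover have "A - {s} \<union> {s} = A" "{1..m} \<union> {?f s} = {1..card A}"
      using s m(1) by auto
    ultimately have bij: "bij_betw ?f A {1..card A}"
      by simp
    have "f x < Suc m" if "x \<in> A - {s}" for x
      using bij_betw_apply[OF f that] by simp
    then have "\<forall>x\<in>A. \<forall>y\<in>A. (x, y) \<in> r \<longrightarrow> ?f x < ?f y"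
      using sink mono by auto
    with bij show ?thesis by blast
  qed
qed

lemma Z_V_edge_iff:
  assumes "inj_on v {1..n}" "i \<in> {1..n}" "j \<in> {1..n}"
  shows "{Z i, V (v j)} \<in> uedges (H_graph n v G) \<longleftrightarrow> i = j \<or> (v i, v j) \<in> arcs_ends G"
  using assms by (auto simp: H_graph_def doubleton_eq_iff dest: inj_onD)

theorem theorem4p2:
  fixes G :: "('a, 'b) pre_digraph" and v :: "nat \<Rightarrow> 'a" and n :: nat
  assumes "digraph G"
    and "bij_betw v {1..n} (verts G)"
  shows "(\<exists>\<pi>. \<pi> permutes {1..n} \<and>
            (\<forall>i\<in>{1..n}. \<forall>j\<in>{1..n}. {Z i, V (v j)} \<in> uedges (H_graph n v G) \<longrightarrow> \<pi> i \<le> \<pi> j))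
         \<longleftrightarrow> directed_acyclic G"
proof -
  interpret digraph G by fact
  note v = assms(2)
  have inj: "inj_on v {1..n}"
    using v by (rule bij_betw_imp_inj_on)
  have acyclic_iff: "directed_acyclic G \<longleftrightarrow> acyclic (arcs_ends G)"
    unfolding directed_acyclic_def acyclic_arcs_ends_iff
    using fin_digraph_axioms by blast
  show ?thesis
    unfolding acyclic_iff
  proof
    assume "\<exists>\<pi>. \<pi> permutes {1..n} \<and>
      (\<forall>i\<in>{1..n}. \<forall>j\<in>{1..n}. {Z i, V (v j)} \<in> uedges (H_graph n v G) \<longrightarrow> \<pi> i \<le> \<pi> j)"
    then obtain \<pi> where \<pi>: "\<pi> permutes {1..n}"
      and le: "\<And>i j. \<lbrakk>i \<in> {1..n}; j \<in> {1..n}; (v i, v j) \<in> arcs_ends G\<rbrakk> \<Longrightarrow> \<pi> i \<le> \<pi> j"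
      by (auto simp: Z_V_edge_iff[OF inj])
    let ?label = "\<lambda>x. \<pi> (inv_into {1..n} v x)"
    have "?label x < ?label y" if xy: "(x, y) \<in> arcs_ends G" for x y
    proof -
      have "x \<in> verts G" "y \<in> verts G" "x \<noteq> y"
        using xy adj_in_verts adj_not_same by auto
      then obtain i j where "i \<in> {1..n}" "j \<in> {1..n}" "x = v i" "y = v j" "i \<noteq> j"
        using v by (metis bij_betw_imp_surj_on imageE)
      then show ?thesis
        using le[of i j] xy inj permutes_inj[OF \<pi>] by (auto simp: less_le dest: injD)
    qed
    then have "arcs_ends G \<subseteq> measure ?label"
      by (auto simp: measure_def)
    then show "acyclic (arcs_ends G)"
      by (rule wf_acyclic[OF wf_subset[OF wf_measure]])
  next
    assume "acyclic (arcs_ends G)"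
    moreover have card: "card (verts G) = n"
      using bij_betw_same_card[OF v] by simp
    ultimately obtain f where f: "bij_betw f (verts G) {1..n}"
      and less: "\<And>x y. \<lbrakk>x \<in> verts G; y \<in> verts G; (x, y) \<in> arcs_ends G\<rbrakk> \<Longrightarrow> f x < f y"
      using acyclic_imp_topological_numbering[OF finite_verts] by metis
    let ?\<pi> = "\<lambda>i. if i \<in> {1..n} then f (v i) else i"
    have "bij_betw ?\<pi> {1..n} {1..n}"
      using bij_betw_trans[OF v f] by (subst bij_betw_cong[where g = "f \<circ> v"]) auto
    then have "?\<pi> permutes {1..n}"
      by (rule bij_imp_permutes) auto
    moreover have "?\<pi> i \<le> ?\<pi> j"
      if "i \<in> {1..n}" "j \<in> {1..n}" "{Z i, V (v j)} \<in> uedges (H_graph n v G)" for i j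
      using that less[of "v i" "v j"] bij_betw_apply[OF v]
      by (auto simp: Z_V_edge_iff[OF inj])
    ultimately show "\<exists>\<pi>. \<pi> permutes {1..n} \<and>
      (\<forall>i\<in>{1..n}. \<forall>j\<in>{1..n}. {Z i, V (v j)} \<in> uedges (H_graph n v G) \<longrightarrow> \<pi> i \<le> \<pi> j)"
      by blast
  qed
qed

end
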